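(* Let $1\le w<n$ be integers and let $F$ be an anti-regular distribution. Let $n$ players have costs drawn independently from $F$. Then the expected total payment of Mechanism 1 for buying $w$ data in expectation from these players, namely $w\,F^{-1}\!\left(\frac wn\right)$, is 2-approximate to the benchmark, i.e. it is at most $2\,w\,E_{v\sim F}[v_{w+1}]$.
   Context: Setting: $n$ players, all with the same data type, each willing to sell one unit (his data) at a private cost drawn independently from $F$ (costs are rescaled so that the privacy factor $\epsilon$ is $1$). $v_1\le\dots\le v_n$ denote the costs in sorted order, so $v_{w+1}$ is the $(w+1)$-st smallest cost. Assumption 1: $F$ has a density $f$ with range $[a,b]\subseteq[0,\infty)$, $f$ is piecewise continuous, and $f(z)>0$ for all $z\in[a,b]$. The virtual cost function is $\phi(z)=z+\frac{F(z)}{f(z)}$. $F$ is anti-regular if it satisfies Assumption 1 and $\phi(z)$ is increasing in $z$. Mechanism 1 in this setting: each player is offered the price $F^{-1}(w/n)$; a player accepts exactly when his cost is at most this price, an accepting player receives this price in expectation, and others receive $0$. Benchmark: $w\,E_{v\sim F}[v_{w+1}]$, the expected total payment of the optimal (payment-minimizing) Bayesian incentive compatible mechanism that always buys $w$ units, for anti-regular $F$. *)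

theory Defs
  imports "HOL-Probability.Probability"
begin

definition piecewise_continuous_on :: "real \<Rightarrow> real \<Rightarrow> (real \<Rightarrow> real) \<Rightarrow> bool" where
  "piecewise_continuous_on a b f \<longleftrightarrow>
     (\<exists>S. finite S \<and> continuous_on ({a..b} - S) f) \<and>
     (\<forall>s\<in>{a..b}.
        (a < s \<longrightarrow> (\<exists>l. (f \<longlongrightarrow> l) (at_left s))) \<and>
        (s < b \<longrightarrow> (\<exists>l. (f \<longlongrightarrow> l) (at_right s))))"

text \<open>
  A distribution is a probability measure \<open>F\<close> on the reals; its distribution function is \<open>cdf F\<close>.
  The density \<open>f\<close> is a parameter of the predicate because positivity, piecewise continuity and the
  virtual cost refer to its pointwise values.
\<close>

definition cost_distribution ::
    "real measure \<Rightarrow> (real \<Rightarrow> real) \<Rightarrow> real \<Rightarrow> real \<Rightarrow> bool" where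
  "cost_distribution F f a b \<longleftrightarrow>
     0 \<le> a \<and> a < b \<and>
     prob_space F \<and>
     f \<in> borel_measurable borel \<and>
     F = density lborel (\<lambda>z. ennreal (f z)) \<and>
     (\<forall>z\<in>{a..b}. 0 < f z) \<and>
     (\<forall>z. z \<notin> {a..b} \<longrightarrow> f z = 0) \<and>
     piecewise_continuous_on a b f"

definition virtual_cost :: "real measure \<Rightarrow> (real \<Rightarrow> real) \<Rightarrow> real \<Rightarrow> real" where
  "virtual_cost F f z = z + cdf F z / f z"

text \<open>``Increasing'' is read in the weak sense.\<close>

definition anti_regular ::
    "real measure \<Rightarrow> (real \<Rightarrow> real) \<Rightarrow> real \<Rightarrow> real \<Rightarrow> bool" where
  "anti_regular F f a b \<longleftrightarrow>
     cost_distribution F f a b \<and> mono_on {a..b} (virtual_cost F f)"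

text \<open>
  \<open>cdf F\<close> is a bijection from \<open>{a..b}\<close> onto \<open>{0..1}\<close> under \<open>cost_distribution F f a b\<close>, but it is
  not injective on the whole line, so its inverse has to be taken relative to \<open>{a..b}\<close>.
\<close>

definition cdf_inv :: "real measure \<Rightarrow> real \<Rightarrow> real \<Rightarrow> real \<Rightarrow> real" where
  "cdf_inv F a b q = the_inv_into {a..b} (cdf F) q"

definition mech_price :: "real measure \<Rightarrow> real \<Rightarrow> real \<Rightarrow> nat \<Rightarrow> nat \<Rightarrow> real" where
  "mech_price F a b n w = cdf_inv F a b (real w / real n)"

text \<open>
  The expected payment of a player with cost \<open>c\<close> who is offered price \<open>p\<close>, where the expectation is
  over the randomness of the mechanism other than the costs.
\<close>

definition mech_payment :: "real \<Rightarrow> real \<Rightarrow> real" where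
  "mech_payment p c = (if c \<le> p then p else 0)"

definition mech_expected_total_payment ::
    "real measure \<Rightarrow> real \<Rightarrow> real \<Rightarrow> nat \<Rightarrow> nat \<Rightarrow> 'w measure \<Rightarrow> (nat \<Rightarrow> 'w \<Rightarrow> real) \<Rightarrow> real" where
  "mech_expected_total_payment F a b n w M C =
     (\<integral>\<omega>. (\<Sum>i<n. mech_payment (mech_price F a b n w) (C i \<omega>)) \<partial>M)"

text \<open>
  \<open>order_statistic n k c\<close> is the \<open>k\<close>-th smallest of \<open>c 0, \<dots>, c (n - 1)\<close>, with multiplicity, for
  \<open>1 \<le> k \<le> n\<close>; list positions start at \<open>0\<close>.
\<close>

definition order_statistic :: "nat \<Rightarrow> nat \<Rightarrow> (nat \<Rightarrow> real) \<Rightarrow> real" where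
  "order_statistic n k c = sort (map c [0..<n]) ! (k - 1)"

text \<open>
  For anti-regular \<open>F\<close> this is the expected total payment of the optimal Bayesian incentive
  compatible mechanism that always buys \<open>w\<close> units; that fact is not part of the definition.
\<close>

definition benchmark :: "nat \<Rightarrow> nat \<Rightarrow> 'w measure \<Rightarrow> (nat \<Rightarrow> 'w \<Rightarrow> real) \<Rightarrow> real" where
  "benchmark n w M C =
     real w * (\<integral>\<omega>. order_statistic n (w + 1) (\<lambda>i. C i \<omega>) \<partial>M)"

end

theory Submission imports Defs begin

text \<open>
  Let \<open>z\<close> be the posted price, so \<open>F(z) = w/n\<close>, and let \<open>T\<^sub>i\<close> be the \<open>w\<close>-th smallest cost among
  the players other than \<open>i\<close>. Player \<open>i\<close> is among the \<open>w\<close> cheapest exactly when \<open>c\<^sub>i < T\<^sub>i\<close> (up to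
  ties), and then \<open>v\<^sub>w\<^sub>+\<^sub>1 = T\<^sub>i\<close>. Hence \<open>w E[v\<^sub>w\<^sub>+\<^sub>1]\<close> is the sum of the \<open>E[T\<^sub>i F(T\<^sub>i)]\<close>, while the
  \<open>E[F(T\<^sub>i)]\<close> add up to \<open>w = n F(z)\<close>. Anti-regularity means that \<open>t F(t)\<close> is a convex function of
  \<open>F(t)\<close>, so Jensen's inequality bounds the first sum below by \<open>n z F(z) = w z\<close>. This gives the
  bound even with factor 1 in place of 2.
\<close>

section \<open>The distribution function on the support interval\<close>

lemma cost_distribution_real_distribution:
  assumes "cost_distribution F f a b"
  shows "real_distribution F"
proof -
  have "prob_space F" "F = density lborel (\<lambda>z. ennreal (f z))"
    using assms by (auto simp: cost_distribution_def)
  then show ?thesis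
    by (metis real_distribution_axioms.intro real_distribution_def sets_density sets_lborel space_density
        space_lborel)
qed

lemma cost_distribution_density_nonneg:
  assumes "cost_distribution F f a b"
  shows "0 \<le> f z"
  using assms unfolding cost_distribution_def by (cases "z \<in> {a..b}") (force intro: less_imp_le)+

lemma cost_distribution_density_integrable:
  assumes "cost_distribution F f a b"
  shows "integrable lborel f"
proof -
  interpret real_distribution F by (rule cost_distribution_real_distribution[OF assms])
  have F: "F = density lborel (\<lambda>z. ennreal (f z))" and f: "f \<in> borel_measurable borel"
    using assms by (auto simp: cost_distribution_def)
  have "integrable F (\<lambda>_. 1::real)" by simp
  then show ?thesis
    using f cost_distribution_density_nonneg[OF assms] by (subst (asm) F, subst (asm) integrable_density) auto
qed

lemma cost_distribution_density_set_integrable: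
  assumes "cost_distribution F f a b" and "S \<in> sets borel"
  shows "set_integrable lborel S f"
  unfolding set_integrable_def
  using assms by (intro integrable_mult_indicator cost_distribution_density_integrable) auto

text \<open>The density vanishes to the left of \<open>a\<close>, so integration can start there. In
  this form the theorems on indefinite integrals give continuity of \<open>cdf F\<close> and its
  derivative wherever \<open>f\<close> is continuous.\<close>

lemma cost_distribution_cdf_eq_integral:
  assumes "cost_distribution F f a b" and "x \<in> {a..b}"
  shows "cdf F x = integral {a..x} f"
proof -
  interpret real_distribution F by (rule cost_distribution_real_distribution[OF assms(1)])
  have F: "F = density lborel (\<lambda>z. ennreal (f z))" and f: "f \<in> borel_measurable borel"
    and out: "\<And>z. z \<notin> {a..b} \<Longrightarrow> f z = 0"
    using assms by (auto simp: cost_distribution_def)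
  have "cdf F x = (\<integral>z. indicator {..x} z \<partial>F)"
    by (simp add: cdf_def)
  also have "\<dots> = (\<integral>z. f z * indicator {..x} z \<partial>lborel)"
    using f cost_distribution_density_nonneg[OF assms(1)] by (subst F, subst integral_density) auto
  also have "\<dots> = (LINT z:{a..x}|lborel. f z)"
    unfolding set_lebesgue_integral_def
    using out by (intro Bochner_Integration.integral_cong) (auto simp: indicator_def)
  also have "\<dots> = integral {a..x} f"
    by (intro set_borel_integral_eq_integral cost_distribution_density_set_integrable[OF assms(1)]) simp
  finally show ?thesis .
qed

lemma cost_distribution_density_integrable_on:
  assumes "cost_distribution F f a b"
  shows "f integrable_on {a..b}"
  by (intro set_borel_integral_eq_integral cost_distribution_density_set_integrable[OF assms]) simp

lemma cost_distribution_AE_in: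
  assumes "cost_distribution F f a b"
  shows "AE x in F. x \<in> {a..b}"
proof -
  have F: "F = density lborel (\<lambda>z. ennreal (f z))" and f: "f \<in> borel_measurable borel"
    and out: "\<And>z. z \<notin> {a..b} \<Longrightarrow> f z = 0"
    using assms by (auto simp: cost_distribution_def)
  show ?thesis
    using f out by (subst F, subst AE_density) (auto, force)
qed

lemma cost_distribution_no_atom:
  assumes "cost_distribution F f a b"
  shows "measure F {x} = 0"
proof -
  have F: "F = density lborel (\<lambda>z. ennreal (f z))" and f: "f \<in> borel_measurable borel"
    using assms by (auto simp: cost_distribution_def)
  have "emeasure F {x} = 0"
    using f by (subst F, subst emeasure_density) (auto simp: nn_integral_0_iff_AE intro: AE_lborel_singleton[THEN eventually_mono])
  then show ?thesis by (simp add: measure_def)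
qed

text \<open>Without atoms ties have probability 0. This reconciles the strict comparison in the
  payment bound with the weak one in the counting bound.\<close>

lemma cost_distribution_measure_lessThan:
  assumes "cost_distribution F f a b"
  shows "measure F {..<x} = cdf F x"
proof -
  interpret real_distribution F by (rule cost_distribution_real_distribution[OF assms])
  have "{..x} = {..<x} \<union> {x}" by auto
  then have "cdf F x = measure F {..<x} + measure F {x}"
    unfolding cdf_def by (simp only:) (intro finite_measure_Union, auto)
  then show ?thesis using cost_distribution_no_atom[OF assms] by simp
qed

lemma cost_distribution_cdf_left:
  assumes "cost_distribution F f a b" shows "cdf F a = 0"
  using assms by (subst cost_distribution_cdf_eq_integral) (auto simp: cost_distribution_def)

lemma cost_distribution_cdf_right:
  assumes "cost_distribution F f a b" shows "cdf F b = 1"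
proof -
  interpret real_distribution F by (rule cost_distribution_real_distribution[OF assms])
  show ?thesis unfolding cdf_def
    by (subst prob_eq_1) (auto intro: eventually_mono[OF cost_distribution_AE_in[OF assms]])
qed

lemma cost_distribution_cdf_continuous_on:
  assumes "cost_distribution F f a b"
  shows "continuous_on {a..b} (cdf F)"
  using indefinite_integral_continuous_1[OF cost_distribution_density_integrable_on[OF assms]]
  by (rule continuous_on_eq) (simp add: cost_distribution_cdf_eq_integral[OF assms])

lemma cost_distribution_cdf_strict_mono_on:
  assumes "cost_distribution F f a b"
  shows "strict_mono_on {a..b} (cdf F)"
proof (rule strict_mono_onI)
  fix x y assume xy: "x \<in> {a..b}" "y \<in> {a..b}" "x < y"
  interpret real_distribution F by (rule cost_distribution_real_distribution[OF assms])
  have F: "F = density lborel (\<lambda>z. ennreal (f z))" and f: "f \<in> borel_measurable borel"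
    and pos: "\<And>z. z \<in> {a..b} \<Longrightarrow> 0 < f z"
    using assms by (auto simp: cost_distribution_def)
  \<comment> \<open>A null interval would force the density to vanish almost everywhere on it, but
    the density is positive there and the interval has positive length.\<close>
  have "emeasure F {x<..y} \<noteq> 0"
  proof
    assume "emeasure F {x<..y} = 0"
    then have "AE z in lborel. ennreal (f z) * indicator {x<..y} z = 0"
      using f by (subst (asm) F, subst (asm) emeasure_density) (auto simp: nn_integral_0_iff_AE)
    then have "AE z in lborel. z \<notin> {x<..y}"
    proof eventually_elim
      case (elim z)
      then show ?case using pos[of z] xy by (auto simp: indicator_def ennreal_eq_0_iff)
    qed
    then have "emeasure lborel {x<..y} = 0"
      by (subst (asm) AE_iff_measurable[where N = "{x<..y}"]) auto
    then show False using xy by simp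
  qed
  then have "0 < measure F {x<..y}"
    by (simp add: emeasure_eq_measure zero_less_measure_iff)
  moreover have "cdf F y - cdf F x = measure F {x<..y}"
    by (rule cdf_diff_eq) (use xy in auto)
  ultimately show "cdf F x < cdf F y" by simp
qed

lemma cost_distribution_cdf_inv:
  assumes "cost_distribution F f a b" and "q \<in> {0..1}"
  shows "cdf_inv F a b q \<in> {a..b}" and "cdf F (cdf_inv F a b q) = q"
proof -
  have ab: "a \<le> b" using assms(1) by (simp add: cost_distribution_def)
  have "\<exists>z\<ge>a. z \<le> b \<and> cdf F z = q"
    using assms(2)
    by (intro IVT' cost_distribution_cdf_continuous_on[OF assms(1)])
      (use ab in \<open>simp_all add: cost_distribution_cdf_left[OF assms(1)] cost_distribution_cdf_right[OF assms(1)]\<close>)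
  then have q: "q \<in> cdf F ` {a..b}" by auto
  have inj: "inj_on (cdf F) {a..b}"
    using cost_distribution_cdf_strict_mono_on[OF assms(1)] by (rule strict_mono_on_imp_inj_on)
  show "cdf_inv F a b q \<in> {a..b}"
    unfolding cdf_inv_def using the_inv_into_into[OF inj q order_refl] .
  show "cdf F (cdf_inv F a b q) = q"
    unfolding cdf_inv_def using f_the_inv_into_f[OF inj q] .
qed

section \<open>Anti-regularity as a tangent inequality\<close>

text \<open>
  In quantile space this says that \<open>q \<mapsto> q * F\<^sup>-\<^sup>1(q)\<close> lies above its tangents: its derivative is
  the virtual cost.
\<close>

lemma anti_regular_tangent:
  assumes "anti_regular F f a b" and z: "z \<in> {a..b}" and t: "t \<in> {a..b}"
  shows "z * cdf F z + virtual_cost F f z * (cdf F t - cdf F z) \<le> t * cdf F t"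
proof -
  define \<phi> where "\<phi> = virtual_cost F f"
  \<comment> \<open>With the slope frozen at \<open>\<phi> z\<close>, the claim says that
    \<open>H\<close> is minimal at \<open>z\<close>. Its derivative
    \<open>f x * (\<phi> x - \<phi> z)\<close> goes from nonpositive to nonnegative at
    \<open>z\<close> because \<open>\<phi>\<close> is increasing.\<close>
  define H where "H x = (x - \<phi> z) * cdf F x" for x
  have cd: "cost_distribution F f a b" and mono: "mono_on {a..b} \<phi>"
    using assms(1) by (auto simp: anti_regular_def \<phi>_def)
  from cd obtain S where S: "finite S" "continuous_on ({a..b} - S) f"
    and pos: "\<And>z. z \<in> {a..b} \<Longrightarrow> 0 < f z"
    by (auto simp: cost_distribution_def piecewise_continuous_on_def)
  have der: "(H has_vector_derivative f x * (\<phi> x - \<phi> z)) (at x)" if x: "x \<in> {a<..<b} - S" for x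
  proof -
    have op: "open ({a<..<b} - S)"
      using S(1) by (intro open_Diff finite_imp_closed) auto
    have nb: "x \<in> interior {a..b}" using x by simp
    have "continuous_on ({a<..<b} - S) f"
      using S(2) by (rule continuous_on_subset) auto
    then have "isCont f x"
      using op x continuous_on_eq_continuous_at by blast
    then have "((\<lambda>u. integral {a..u} f) has_vector_derivative f x) (at x within {a..b})"
      using x integral_has_vector_derivative_continuous_at[where S = "{}",
          OF cost_distribution_density_integrable_on[OF cd], of x]
      by (auto intro: continuous_at_imp_continuous_at_within)
    then have "(cdf F has_vector_derivative f x) (at x within {a..b})"
      by (rule has_vector_derivative_transform[rotated 2])
        (use x cost_distribution_cdf_eq_integral[OF cd] in auto)
    then have "(cdf F has_real_derivative f x) (at x)"
      using at_within_interior[OF nb] by (simp add: has_real_derivative_iff_has_vector_derivative)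
    then have "(H has_real_derivative (1 * cdf F x + f x * (x - \<phi> z))) (at x)"
      unfolding H_def by (auto intro!: derivative_eq_intros)
    moreover have "1 * cdf F x + f x * (x - \<phi> z) = f x * (\<phi> x - \<phi> z)"
      using pos[of x] x by (simp add: \<phi>_def virtual_cost_def field_simps)
    ultimately show ?thesis
      by (simp add: has_real_derivative_iff_has_vector_derivative)
  qed
  \<comment> \<open>The finitely many points of \<open>S\<close>, where \<open>H\<close> may fail to
    be differentiable, do no harm because \<open>H\<close> is continuous.\<close>
  have int: "((\<lambda>x. f x * (\<phi> x - \<phi> z)) has_integral (H v - H u)) {u..v}"
    if "a \<le> u" "u \<le> v" "v \<le> b" for u v
  proof (rule fundamental_theorem_of_calculus_interior_strong[OF S(1) that(2)])
    show "continuous_on {u..v} H"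
      unfolding H_def using that
      by (intro continuous_intros continuous_on_subset[OF cost_distribution_cdf_continuous_on[OF cd]]) auto
  qed (use der that in auto)
  have "H z \<le> H t"
  proof (cases "z \<le> t")
    case True
    have "0 \<le> H t - H z"
      by (rule has_integral_nonneg[OF int])
        (use True z t pos in \<open>auto intro!: mult_nonneg_nonneg less_imp_le[OF pos] mono_onD[OF mono]\<close>)
    then show ?thesis by simp
  next
    case False
    have "0 \<le> - (H z - H t)"
      by (rule has_integral_nonneg[OF has_integral_neg[OF int]])
        (use False z t pos in \<open>auto intro!: mult_nonneg_nonpos less_imp_le[OF pos] mono_onD[OF mono]\<close>)
    then show ?thesis by simp
  qed
  then show ?thesis by (simp add: H_def \<phi>_def algebra_simps)
qed

section \<open>Order statistics through counting\<close>

lemma length_filter_sort_map: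
  "length (filter P (sort (map c [0..<n]))) = card {j. j < n \<and> P (c j)}"
  for c :: "nat \<Rightarrow> real"
proof -
  have "length (filter P (sort (map c [0..<n]))) = size (filter_mset P (mset (map c [0..<n])))"
    by (metis mset_filter mset_sort size_mset)
  also have "\<dots> = length (filter (\<lambda>j. P (c j)) [0..<n])"
    by (metis (no_types, lifting) comp_apply filter_cong filter_map length_map mset_filter size_mset)
  also have "\<dots> = card {j. j < n \<and> P (c j)}"
    by (subst distinct_card[symmetric]) (auto intro!: arg_cong[where f = card])
  finally show ?thesis .
qed

text \<open>For a downward closed \<open>P\<close>, the entries of a sorted list that satisfy
  \<open>P\<close> form a prefix, so membership of a position is a matter of the length of that
  prefix.\<close>

lemma sorted_nth_iff_less_length_filter:
  fixes xs :: "'a::linorder list"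
  assumes "sorted xs" "k < length xs" and down: "\<And>x y. x \<le> y \<Longrightarrow> P y \<Longrightarrow> P x"
  shows "P (xs ! k) \<longleftrightarrow> k < length (filter P xs)"
  using assms(1,2)
proof (induction xs arbitrary: k)
  case (Cons y ys)
  show ?case
  proof (cases "P y")
    case True
    then show ?thesis using Cons by (cases k) auto
  next
    case False
    then have "\<not> P x" if "x \<in> set (y # ys)" for x
      using Cons.prems(1) down that by auto
    then show ?thesis
      using nth_mem[OF Cons.prems(2)] by (metis filter_False list.size(3) not_less_zero)
  qed
qed simp

text \<open>This and its strict variant replace sorted lists by cardinalities in the comparisons
  that follow.\<close>

lemma order_statistic_le_iff:
  assumes "1 \<le> k" "k \<le> n"
  shows "order_statistic n k c \<le> x \<longleftrightarrow> k \<le> card {j. j < n \<and> c j \<le> x}"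
  unfolding order_statistic_def using assms
  by (subst sorted_nth_iff_less_length_filter[where P = "\<lambda>y. y \<le> x"]) (auto simp: length_filter_sort_map)

lemma order_statistic_less_iff:
  assumes "1 \<le> k" "k \<le> n"
  shows "order_statistic n k c < x \<longleftrightarrow> k \<le> card {j. j < n \<and> c j < x}"
  unfolding order_statistic_def using assms
  by (subst sorted_nth_iff_less_length_filter[where P = "\<lambda>y. y < x"]) (auto simp: length_filter_sort_map)

text \<open>Lowering entries can only increase the number of entries below a given
  threshold.\<close>

lemma order_statistic_mono:
  assumes "1 \<le> k" "k \<le> n" "\<And>j. j < n \<Longrightarrow> c j \<le> d j"
  shows "order_statistic n k c \<le> order_statistic n k d"
proof -
  let ?v = "order_statistic n k d"
  have "k \<le> card {j. j < n \<and> d j \<le> ?v}"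
    using order_statistic_le_iff[OF assms(1,2), of d ?v] by simp
  also have "\<dots> \<le> card {j. j < n \<and> c j \<le> ?v}"
    using assms(3) by (intro card_mono) (auto intro: order_trans)
  finally show ?thesis
    using order_statistic_le_iff[OF assms(1,2)] by simp
qed

lemma order_statistic_in_image:
  assumes "1 \<le> k" "k \<le> n"
  shows "order_statistic n k c \<in> c ` {..<n}"
proof -
  have "order_statistic n k c \<in> set (sort (map c [0..<n]))"
    unfolding order_statistic_def using assms by (intro nth_mem) simp
  then show ?thesis by auto
qed

lemma order_statistic_cong:
  assumes "\<And>j. j < n \<Longrightarrow> c j = d j"
  shows "order_statistic n k c = order_statistic n k d"
  unfolding order_statistic_def using assms by (metis atLeastLessThan_iff list.map_cong0 set_upt)

lemma borel_measurable_order_statistic: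
  assumes "1 \<le> k" "k \<le> n" "\<And>j. j < n \<Longrightarrow> X j \<in> borel_measurable M"
  shows "(\<lambda>\<omega>. order_statistic n k (\<lambda>j. X j \<omega>)) \<in> borel_measurable M"
proof -
  have "{\<omega> \<in> space M. order_statistic n k (\<lambda>j. X j \<omega>) \<le> x} \<in> sets M" for x
  proof -
    \<comment> \<open>Writing the count as a finite sum of indicators makes the sublevel sets
      measurable.\<close>
    have "(\<Sum>j<n. indicator {..x} (X j \<omega>)) = real (card {j. j < n \<and> X j \<omega> \<le> x})" for \<omega>
      by (simp add: indicator_def sum.If_cases Int_def)
    then have "{\<omega> \<in> space M. order_statistic n k (\<lambda>j. X j \<omega>) \<le> x} =
        {\<omega> \<in> space M. real k \<le> (\<Sum>j<n. indicator {..x} (X j \<omega>))}"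
      by (simp only: order_statistic_le_iff[OF assms(1,2)] of_nat_le_iff)
    moreover have "(\<lambda>\<omega>. \<Sum>j<n. indicator {..x} (X j \<omega>) :: real) \<in> borel_measurable M"
      using assms(3) by (intro borel_measurable_sum measurable_compose[OF assms(3)]) auto
    ultimately show ?thesis by simp
  qed
  then show ?thesis by (simp add: borel_measurable_iff_le)
qed

section \<open>Critical values for a fixed cost profile\<close>

text \<open>
  As no cost is below \<open>a\<close>, \<open>order_statistic n (w + 1) (c(i := a))\<close> is the \<open>w\<close>-th smallest among
  the costs of the players other than \<open>i\<close>: the critical value below which \<open>i\<close> is one of the \<open>w\<close> cheapest players.
\<close>

lemma sum_critical_values_le:
  fixes c :: "nat \<Rightarrow> real"
  assumes "w < n" "0 \<le> a" "\<And>j. j < n \<Longrightarrow> a \<le> c j"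
  defines "T \<equiv> \<lambda>i. order_statistic n (w + 1) (c(i := a))"
  shows "(\<Sum>i<n. T i * indicator {..<T i} (c i)) \<le> real w * order_statistic n (w + 1) c"
proof -
  define v where "v = order_statistic n (w + 1) c"
  \<comment> \<open>Resetting one cost to the lower bound \<open>a\<close> cannot raise an order
    statistic.\<close>
  have Tv: "T i \<le> v" for i
    unfolding T_def v_def using assms by (intro order_statistic_mono) auto
  have "v \<in> c ` {..<n}"
    unfolding v_def using assms by (intro order_statistic_in_image) auto
  then have v0: "0 \<le> v" using assms(2,3) by force
  \<comment> \<open>Since \<open>T i \<le> v\<close>, a player below his critical value is also
    below \<open>v\<close>, and \<open>v \<ge> 0\<close> covers the remaining players.\<close>
  have "(\<Sum>i<n. T i * indicator {..<T i} (c i)) \<le> (\<Sum>i<n. v * indicator {..<v} (c i))"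
  proof (rule sum_mono)
    fix i show "T i * indicator {..<T i} (c i) \<le> v * indicator {..<v} (c i)"
      using Tv[of i] v0 by (auto simp: indicator_def)
  qed
  also have "\<dots> = v * real (card {j. j < n \<and> c j < v})"
    by (simp add: sum_distrib_left[symmetric] indicator_def sum.If_cases Int_def)
  \<comment> \<open>At most \<open>w\<close> costs lie strictly below the \<open>(w + 1)\<close>-st
    smallest, even with ties.\<close>
  also have "\<dots> \<le> v * real w"
    using order_statistic_less_iff[of "w + 1" n c v] assms(1) v0
    by (intro mult_left_mono) (auto simp: v_def)
  finally show ?thesis by (simp add: v_def mult.commute)
qed

text \<open>Every player whose cost is at most the \<open>w\<close>-th smallest is at or below his
  own critical value, and there are at least \<open>w\<close> such players. The weak comparison
  keeps this true with ties.\<close>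

lemma le_sum_below_critical_value:
  fixes c :: "nat \<Rightarrow> real" and a :: real
  assumes "1 \<le> w" "w < n"
  defines "T \<equiv> \<lambda>i. order_statistic n (w + 1) (c(i := a))"
  shows "real w \<le> (\<Sum>i<n. indicator {..T i} (c i))"
proof -
  have below: "c i \<le> T i" if i: "i < n" "c i \<le> order_statistic n w c" for i
  proof (rule ccontr)
    assume "\<not> c i \<le> T i"
    \<comment> \<open>Of the \<open>w + 1\<close> modified entries below \<open>c i\<close>, at most
      one is the reset entry \<open>i\<close>. The other \<open>w\<close> are original costs, so the
      \<open>w\<close>-th smallest cost is already below \<open>c i\<close>.\<close>
    then have "w + 1 \<le> card {j. j < n \<and> (c(i := a)) j < c i}"
      using order_statistic_less_iff[of "w + 1" n "c(i := a)" "c i"] assms by simp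
    also have "\<dots> \<le> card (insert i {j. j < n \<and> c j < c i})"
      by (intro card_mono) auto
    also have "\<dots> = card {j. j < n \<and> c j < c i} + 1" by simp
    finally have "order_statistic n w c < c i"
      using order_statistic_less_iff[of w n c "c i"] assms by simp
    then show False using i by simp
  qed
  have "w \<le> card {j. j < n \<and> c j \<le> order_statistic n w c}"
    using order_statistic_le_iff[of w n c "order_statistic n w c"] assms by simp
  also have "\<dots> \<le> card {j. j < n \<and> c j \<le> T j}"
    using below by (intro card_mono) auto
  also have "real \<dots> = (\<Sum>i<n. indicator {..T i} (c i))"
    by (simp add: indicator_def sum.If_cases Int_def)
  finally show ?thesis by simp
qed

section \<open>Integrating out one player's cost\<close>

text \<open>Independence makes the joint law a product measure, so Fubini allows \<open>X\<close> to
  be integrated out with \<open>Y\<close> held fixed.\<close>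

lemma (in prob_space) expectation_indep_var:
  fixes h :: "'b \<Rightarrow> 'b \<Rightarrow> real"
  assumes "indep_var S X N Y" and "integrable M (\<lambda>\<omega>. h (X \<omega>) (Y \<omega>))"
    and h: "case_prod h \<in> borel_measurable (S \<Otimes>\<^sub>M N)"
  shows "expectation (\<lambda>\<omega>. h (X \<omega>) (Y \<omega>)) = expectation (\<lambda>\<omega>. \<integral>x. h x (Y \<omega>) \<partial>distr M S X)"
proof -
  have X[measurable]: "X \<in> measurable M S" and Y[measurable]: "Y \<in> measurable M N"
    and eq: "distr M S X \<Otimes>\<^sub>M distr M N Y = distr M (S \<Otimes>\<^sub>M N) (\<lambda>x. (X x, Y x))"
    using assms(1) by (auto simp: indep_var_distribution_eq)
  interpret X: prob_space "distr M S X" by (rule prob_space_distr) fact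
  interpret Y: prob_space "distr M N Y" by (rule prob_space_distr) fact
  interpret XY: pair_prob_space "distr M S X" "distr M N Y" ..
  have int: "integrable (distr M S X \<Otimes>\<^sub>M distr M N Y) (case_prod h)"
    unfolding eq using assms(2) h by (subst integrable_distr_eq) auto
  have "expectation (\<lambda>\<omega>. h (X \<omega>) (Y \<omega>)) = (\<integral>z. case_prod h z \<partial>(distr M S X \<Otimes>\<^sub>M distr M N Y))"
    unfolding eq using h by (subst integral_distr) auto
  also have "\<dots> = (\<integral>y. \<integral>x. h x y \<partial>distr M S X \<partial>distr M N Y)"
    using XY.integral_snd[OF int] by simp
  also have "\<dots> = expectation (\<lambda>\<omega>. \<integral>x. h x (Y \<omega>) \<partial>distr M S X)"
    using borel_measurable_integrable[OF XY.integrable_snd[OF int]] by (subst integral_distr) auto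
  finally show ?thesis .
qed

text \<open>Overwriting coordinate \<open>i\<close> leaves a function of the other players' costs
  only.\<close>

lemma (in prob_space) indep_var_order_statistic_upd:
  fixes C :: "nat \<Rightarrow> 'a \<Rightarrow> real"
  assumes "indep_vars (\<lambda>_. borel) C {..<n}" "i < n" "1 \<le> k" "k \<le> n"
  shows "indep_var borel (C i) borel (\<lambda>\<omega>. order_statistic n k ((\<lambda>j. C j \<omega>)(i := a)))"
proof -
  let ?J = "{..<n} - {i}"
  let ?T = "\<lambda>g. order_statistic n k (g(i := a))"
  have "?T \<in> borel_measurable (PiM ?J (\<lambda>_. borel))"
  proof (rule borel_measurable_order_statistic)
    fix j assume "j < n"
    then show "(\<lambda>g. (g(i := a)) j) \<in> borel_measurable (PiM ?J (\<lambda>_. borel))"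
      by (cases "j = i") (auto intro!: measurable_component_singleton)
  qed (use assms in auto)
  then have "indep_var borel ((\<lambda>g. g i) \<circ> (\<lambda>\<omega>. restrict (\<lambda>j. C j \<omega>) {i}))
      borel (?T \<circ> (\<lambda>\<omega>. restrict (\<lambda>j. C j \<omega>) ?J))"
    using assms by (intro indep_var_compose[OF indep_var_restrict[OF assms(1)]]) auto
  \<comment> \<open>The restriction to \<open>?J\<close> is undefined at \<open>i\<close>, but
    \<open>?T\<close> overwrites exactly that coordinate.\<close>
  moreover have "?T \<circ> (\<lambda>\<omega>. restrict (\<lambda>j. C j \<omega>) ?J) = (\<lambda>\<omega>. ?T (\<lambda>j. C j \<omega>))"
    unfolding comp_def by (intro ext order_statistic_cong) auto
  moreover have "(\<lambda>g. g i) \<circ> (\<lambda>\<omega>. restrict (\<lambda>j. C j \<omega>) {i}) = C i"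
    by auto
  ultimately show ?thesis by simp
qed

text \<open>Given \<open>T\<close>, both indicators have mean \<open>cdf F (T \<omega>)\<close>. The
  bound is then Jensen's inequality, obtained by averaging the tangent inequality at
  \<open>z\<close>.\<close>

lemma (in prob_space) expectation_critical_payment:
  assumes ar: "anti_regular F f a b" and ind: "indep_var borel X borel T"
    and F: "distr M borel X = F" and T: "AE \<omega> in M. T \<omega> \<in> {a..b}" and z: "z \<in> {a..b}"
  shows "z * cdf F z + virtual_cost F f z * (expectation (\<lambda>\<omega>. indicator {..T \<omega>} (X \<omega>)) - cdf F z)
    \<le> expectation (\<lambda>\<omega>. T \<omega> * indicator {..<T \<omega>} (X \<omega>))"
    and "integrable M (\<lambda>\<omega>. T \<omega> * indicator {..<T \<omega>} (X \<omega>))"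
    and "integrable M (\<lambda>\<omega>. indicator {..T \<omega>} (X \<omega>) :: real)"
proof -
  have cd: "cost_distribution F f a b" using ar by (simp add: anti_regular_def)
  interpret F: real_distribution F by (rule cost_distribution_real_distribution[OF cd])
  have [measurable]: "X \<in> borel_measurable M" "T \<in> borel_measurable M"
    using ind by (auto simp: indep_var_distribution_eq)
  have [measurable]: "cdf F \<in> borel_measurable borel"
    by (intro borel_measurable_mono monoI F.cdf_nondecreasing)
  have a0: "0 \<le> a" and b0: "0 \<le> b" using cd by (auto simp: cost_distribution_def)
  \<comment> \<open>An indicator of a random set becomes a comparison of two measurable functions,
    which makes its joint measurability routine.\<close>
  have less_eq: "indicator {..<t} x = (if x < t then 1 else 0::real)"
    and le_eq: "indicator {..t} x = (if x \<le> t then 1 else 0::real)" for t x :: real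
    by auto
  show int1: "integrable M (\<lambda>\<omega>. T \<omega> * indicator {..<T \<omega>} (X \<omega>))"
    unfolding less_eq
    by (rule integrable_const_bound[of _ b]) (use a0 b0 T in \<open>auto elim: eventually_mono\<close>)
  show int2: "integrable M (\<lambda>\<omega>. indicator {..T \<omega>} (X \<omega>) :: real)"
    unfolding le_eq by (rule integrable_const_bound[of _ 1]) auto
  have E1: "expectation (\<lambda>\<omega>. T \<omega> * indicator {..<T \<omega>} (X \<omega>)) = expectation (\<lambda>\<omega>. T \<omega> * cdf F (T \<omega>))"
  proof (subst expectation_indep_var[OF ind int1])
    show "(\<lambda>(x, t). t * indicator {..<t} x :: real) \<in> borel_measurable (borel \<Otimes>\<^sub>M borel)"
      unfolding less_eq by simp
  qed (simp add: F cost_distribution_measure_lessThan[OF cd])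
  have E2: "expectation (\<lambda>\<omega>. indicator {..T \<omega>} (X \<omega>)) = expectation (\<lambda>\<omega>. cdf F (T \<omega>))"
  proof (subst expectation_indep_var[OF ind int2])
    show "(\<lambda>(x, t::real). indicator {..t} x :: real) \<in> borel_measurable (borel \<Otimes>\<^sub>M borel)"
      unfolding le_eq by simp
  qed (simp add: F cdf_def)
  have intF: "integrable M (\<lambda>\<omega>. cdf F (T \<omega>))"
    by (rule integrable_const_bound[of _ 1]) (auto simp: F.cdf_nonneg F.cdf_bounded_prob)
  have intTF: "integrable M (\<lambda>\<omega>. T \<omega> * cdf F (T \<omega>))"
    by (rule integrable_const_bound[of _ "b * 1"])
      (use a0 T in \<open>auto simp: abs_mult F.cdf_nonneg F.cdf_bounded_prob simp del: mult_1_right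
         intro!: mult_mono elim: eventually_mono\<close>)
  have "z * cdf F z + virtual_cost F f z * (expectation (\<lambda>\<omega>. cdf F (T \<omega>)) - cdf F z) =
      expectation (\<lambda>\<omega>. z * cdf F z + virtual_cost F f z * (cdf F (T \<omega>) - cdf F z))"
    using intF by (simp add: prob_space)
  also have "\<dots> \<le> expectation (\<lambda>\<omega>. T \<omega> * cdf F (T \<omega>))"
    using intF intTF
    by (intro integral_mono_AE eventually_mono[OF T] anti_regular_tangent[OF ar z]) auto
  finally show "z * cdf F z + virtual_cost F f z * (expectation (\<lambda>\<omega>. indicator {..T \<omega>} (X \<omega>)) - cdf F z)
    \<le> expectation (\<lambda>\<omega>. T \<omega> * indicator {..<T \<omega>} (X \<omega>))"
    by (simp add: E1 E2)
qed

section \<open>Summation over the players\<close>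

theorem theorem4p6:
  fixes n w :: nat
    and F :: "real measure" and f :: "real \<Rightarrow> real" and a b :: real
    and M :: "'w measure" and C :: "nat \<Rightarrow> 'w \<Rightarrow> real"
  assumes "1 \<le> w" and "w < n"
    and "anti_regular F f a b"
    and "prob_space M"
    and "prob_space.indep_vars M (\<lambda>_. borel) C {..<n}"
    and "\<And>i. i < n \<Longrightarrow> distr M borel (C i) = F"
  shows "mech_expected_total_payment F a b n w M C = real w * cdf_inv F a b (real w / real n)
    \<and> mech_expected_total_payment F a b n w M C \<le> 2 * benchmark n w M C"
proof -
  interpret prob_space M by fact
  note w = assms(1,2) and ar = assms(3) and ind = assms(5) and distr = assms(6)
  have cd: "cost_distribution F f a b" using ar by (simp add: anti_regular_def)
  interpret F: real_distribution F by (rule cost_distribution_real_distribution[OF cd])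
  have a0: "0 \<le> a" using cd by (simp add: cost_distribution_def)
  have C[measurable]: "C i \<in> borel_measurable M" if "i < n" for i
    using ind that by (auto simp: indep_vars_def)
  define z where "z = cdf_inv F a b (real w / real n)"
  have z: "z \<in> {a..b}" and Fz: "cdf F z = real w / real n"
    unfolding z_def using w by (intro cost_distribution_cdf_inv[OF cd]; simp)+
  have nFz: "real n * cdf F z = real w" using w Fz by simp
  define \<phi> where "\<phi> = virtual_cost F f z"
  \<comment> \<open>The tangent slope must be nonnegative, as the expected number of players at or
    below their critical values is bounded only from below, by \<open>w\<close>.\<close>
  have \<phi>: "0 \<le> \<phi>"
    unfolding \<phi>_def virtual_cost_def using z a0 F.cdf_nonneg cost_distribution_density_nonneg[OF cd]
    by (auto intro!: add_nonneg_nonneg divide_nonneg_nonneg)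
  define T where "T i \<omega> = order_statistic n (w + 1) ((\<lambda>j. C j \<omega>)(i := a))" for i \<omega>
  define v where "v \<omega> = order_statistic n (w + 1) (\<lambda>j. C j \<omega>)" for \<omega>

  have pay: "expectation (\<lambda>\<omega>. mech_payment z (C i \<omega>)) = z * cdf F z"
    and pay_int: "integrable M (\<lambda>\<omega>. mech_payment z (C i \<omega>))" if i: "i < n" for i
  proof -
    note [measurable] = C[OF i]
    have eq: "mech_payment z c = z * indicator {..z} c" for c
      by (simp add: mech_payment_def)
    show "integrable M (\<lambda>\<omega>. mech_payment z (C i \<omega>))"
      unfolding mech_payment_def by (rule integrable_const_bound[of _ "\<bar>z\<bar>"]) auto
    have "expectation (\<lambda>\<omega>. mech_payment z (C i \<omega>)) = (\<integral>c. z * indicator {..z} c \<partial>distr M borel (C i))"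
      unfolding eq by (subst integral_distr) auto
    then show "expectation (\<lambda>\<omega>. mech_payment z (C i \<omega>)) = z * cdf F z"
      by (simp add: distr[OF i] cdf_def)
  qed
  \<comment> \<open>Each player contributes \<open>z * cdf F z\<close>, and
    \<open>n * cdf F z = w\<close>.\<close>
  have mech: "mech_expected_total_payment F a b n w M C = real w * z"
    using pay pay_int nFz
    by (simp add: mech_expected_total_payment_def mech_price_def z_def[symmetric])

  have C_bounds: "AE \<omega> in M. \<forall>i\<in>{..<n}. C i \<omega> \<in> {a..b}"
  proof (intro AE_finite_allI)
    fix i assume "i \<in> {..<n}"
    then show "AE \<omega> in M. C i \<omega> \<in> {a..b}"
      using cost_distribution_AE_in[OF cd] C[of i]
      by (subst (asm) distr[symmetric, of i]) (auto simp: AE_distr_iff)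
  qed simp
  have ab: "a \<in> {a..b}" using cd by (simp add: cost_distribution_def)
  \<comment> \<open>The critical value is one of the costs or the inserted \<open>a\<close>, which
    also lies in the interval.\<close>
  have T_bounds: "AE \<omega> in M. T i \<omega> \<in> {a..b}" for i
    using C_bounds
  proof eventually_elim
    case (elim \<omega>)
    then show ?case
      using order_statistic_in_image[of "w + 1" n "(\<lambda>j. C j \<omega>)(i := a)"] w ab
      by (auto simp: T_def split: if_splits)
  qed
  have v_bounds: "AE \<omega> in M. v \<omega> \<in> {a..b}"
    using C_bounds
  proof eventually_elim
    case (elim \<omega>)
    then show ?case
      using order_statistic_in_image[of "w + 1" n "\<lambda>j. C j \<omega>"] w by (auto simp: v_def)
  qed
  have v_meas: "v \<in> borel_measurable M"
    unfolding v_def[abs_def] using w by (intro borel_measurable_order_statistic C) auto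
  have v_int: "integrable M v"
    by (rule integrable_const_bound[of _ b]) (use a0 v_bounds v_meas in \<open>auto elim: eventually_mono\<close>)

  have indT: "indep_var borel (C i) borel (T i)" if "i < n" for i
    unfolding T_def[abs_def] using w that by (intro indep_var_order_statistic_upd[OF ind]) auto
  note crit = expectation_critical_payment[OF ar indT distr T_bounds z, folded \<phi>_def]

  have "real w = expectation (\<lambda>\<omega>. real w)" by (simp add: prob_space)
  also have "\<dots> \<le> expectation (\<lambda>\<omega>. \<Sum>i<n. indicator {..T i \<omega>} (C i \<omega>))"
    unfolding T_def using crit(3)[unfolded T_def] w
    by (intro integral_mono le_sum_below_critical_value[of w n "\<lambda>j. C j _"]) auto
  also have "\<dots> = (\<Sum>i<n. expectation (\<lambda>\<omega>. indicator {..T i \<omega>} (C i \<omega>)))"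
    using crit(3) by (intro Bochner_Integration.integral_sum) auto
  finally have "0 \<le> (\<Sum>i<n. expectation (\<lambda>\<omega>. indicator {..T i \<omega>} (C i \<omega>))) - real n * cdf F z"
    by (simp add: nFz)
  \<comment> \<open>Adding the nonnegative slope term prepares the sum of the players' tangent
    bounds.\<close>
  then have "real w * z \<le> real n * cdf F z * z +
      \<phi> * ((\<Sum>i<n. expectation (\<lambda>\<omega>. indicator {..T i \<omega>} (C i \<omega>))) - real n * cdf F z)"
    using \<phi> by (simp add: nFz)
  also have "\<dots> = (\<Sum>i<n. z * cdf F z + \<phi> * (expectation (\<lambda>\<omega>. indicator {..T i \<omega>} (C i \<omega>)) - cdf F z))"
    by (simp add: sum.distrib sum_distrib_left[symmetric] sum_subtractf algebra_simps)
  also have "\<dots> \<le> (\<Sum>i<n. expectation (\<lambda>\<omega>. T i \<omega> * indicator {..<T i \<omega>} (C i \<omega>)))"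
    using crit(1) by (intro sum_mono) auto
  also have "\<dots> = expectation (\<lambda>\<omega>. \<Sum>i<n. T i \<omega> * indicator {..<T i \<omega>} (C i \<omega>))"
    using crit(2) by (intro Bochner_Integration.integral_sum[symmetric]) auto
  also have "\<dots> \<le> expectation (\<lambda>\<omega>. real w * v \<omega>)"
  proof (rule integral_mono_AE)
    show "integrable M (\<lambda>\<omega>. \<Sum>i<n. T i \<omega> * indicator {..<T i \<omega>} (C i \<omega>))"
      using crit(2) by (intro Bochner_Integration.integrable_sum) auto
    show "AE \<omega> in M. (\<Sum>i<n. T i \<omega> * indicator {..<T i \<omega>} (C i \<omega>)) \<le> real w * v \<omega>"
      using C_bounds
    proof eventually_elim
      case (elim \<omega>)
      then show ?case
        unfolding T_def v_def using w a0 by (intro sum_critical_values_le) auto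
    qed
  qed (use v_int in auto)
  also have "\<dots> = benchmark n w M C"
    by (simp add: benchmark_def v_def)
  finally have "real w * z \<le> benchmark n w M C" .
  \<comment> \<open>The benchmark is thus nonnegative, so the bound with factor 1 implies the one
    with factor 2.\<close>
  moreover have "0 \<le> real w * z" using z a0 by simp
  ultimately show ?thesis
    using mech by (simp add: z_def)
qed

end
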